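(* Let $k\in\mathbb{R}^n$, $K=\mathrm{circ}(k)\in\mathbb{R}^{n\times n}$, and let $B=\mathrm{circ}(b)\in\mathbb{R}^{n\times n}$, where $b\in\mathbb{R}^n$ is given (together with some $\lambda\in\mathbb{R}$) by $$\begin{pmatrix}2KK^T & k\\ k^T & 0\end{pmatrix}\begin{pmatrix}b\\ \lambda\end{pmatrix}=\begin{pmatrix}0\\ 1\end{pmatrix}.$$ Then $B$ attains the minimum in $$\min_{B\in\mathbb{R}^{n\times n}}\|B^TK\|_F^2\quad\text{s.t. } B_{:,i}^TK_{:,i}=1\ \text{ for } i=1,\dots,n .$$
   Context: For $v\in\mathbb{R}^n$, $\mathrm{circ}(v)\in\mathbb{R}^{n\times n}$ is the circulant matrix whose $i$-th column is $T^{i-1}v$, where $T$ is the $n\times n$ cyclic shift matrix, $T(v_1,\dots,v_n)^T=(v_n,v_1,\dots,v_{n-1})^T$. $A_{:,i}$ denotes the $i$-th column of $A$ and $\|\cdot\|_F$ the Frobenius norm. *)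

theory Defs
  imports Complex_Main "Jordan_Normal_Form.Matrix"
begin

definition cyclic_shift :: "nat \<Rightarrow> real mat" where
  "cyclic_shift n = mat n n (\<lambda>(i, j). if i = Suc j mod n then 1 else 0)"

lemma cyclic_shift_mult_vec:
  assumes v: "v \<in> carrier_vec n"
  shows "cyclic_shift n *\<^sub>v v = vec n (\<lambda>i. if i = 0 then v $ (n - 1) else v $ (i - 1))"
proof (rule eq_vecI)
  fix i assume "i < dim_vec (vec n (\<lambda>i. if i = 0 then v $ (n - 1) else v $ (i - 1)))"
  then have i: "i < n" by simp
  define p where "p = (if i = 0 then n - 1 else i - 1)"
  have p: "p < n" using i by (auto simp: p_def)
  have eq: "i = Suc j mod n \<longleftrightarrow> j = p" if "j < n" for j
    using that i by (cases "Suc j = n") (auto simp: p_def)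
  have "(cyclic_shift n *\<^sub>v v) $ i = (\<Sum>j = 0..<n. (if i = Suc j mod n then 1 else 0) * v $ j)"
    using i v by (auto simp: cyclic_shift_def scalar_prod_def intro!: sum.cong)
  also have "\<dots> = (\<Sum>j = 0..<n. if j = p then v $ j else 0)"
    by (intro sum.cong) (auto simp: eq)
  also have "\<dots> = v $ p" using p by simp
  finally show "(cyclic_shift n *\<^sub>v v) $ i
      = vec n (\<lambda>i. if i = 0 then v $ (n - 1) else v $ (i - 1)) $ i"
    using i by (simp add: p_def)
qed (simp add: cyclic_shift_def)

text \<open>Columns are numbered from 0, so that column \<open>i\<close> is \<open>T ^ i\<close> applied to \<open>v\<close>.\<close>

definition circ :: "real vec \<Rightarrow> real mat" where
  "circ v = (let n = dim_vec v in
     mat_of_cols n (map (\<lambda>i. (cyclic_shift n ^\<^sub>m i) *\<^sub>v v) [0..<n]))"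

definition frobenius_norm :: "real mat \<Rightarrow> real" where
  "frobenius_norm A = sqrt (\<Sum>i<dim_row A. \<Sum>j<dim_col A. (A $$ (i, j))\<^sup>2)"

end

theory Submission
  imports Defs "Jordan_Normal_Form.Determinant"
begin

text \<open>The objective and the constraints decouple over the columns: with \<open>c\<^sub>i\<close>, \<open>k\<^sub>i\<close> the
columns of \<open>C\<close> and \<open>K\<close>, the \<open>i\<close>-th problem is to minimise the squared norm of \<open>K\<^sup>T c\<^sub>i\<close>
subject to \<open>c\<^sub>i \<bullet> k\<^sub>i = 1\<close>. The linear system is the KKT system for \<open>i = 0\<close>. The shift \<open>T\<close> is
orthogonal and commutes with \<open>K\<close>, hence also with \<open>K K\<^sup>T\<close>, so applying \<open>T\<^sup>i\<close> to the system shows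
that \<open>b\<^sub>i = T\<^sup>i b\<close> solves the KKT system of the \<open>i\<close>-th column. Then
\<open>K\<^sup>T c\<^sub>i \<bullet> K\<^sup>T b\<^sub>i = - \<lambda> / 2\<close> for every feasible \<open>c\<^sub>i\<close>, including \<open>b\<^sub>i\<close>, and optimality follows
by expanding the squared norm of \<open>K\<^sup>T c\<^sub>i - K\<^sup>T b\<^sub>i\<close>.\<close>

section \<open>Matrix powers, squared norms and the column-wise objective\<close>

lemma pow_mat_mult_vec:
  fixes A :: "'a :: comm_semiring_1 mat"
  assumes A: "A \<in> carrier_mat n n" and v: "v \<in> carrier_vec n"
  shows "(A ^\<^sub>m m) *\<^sub>v v = ((\<lambda>w. A *\<^sub>v w) ^^ m) v"
  using v
proof (induction m arbitrary: v)
  case (Suc m)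
  \<comment> \<open>The matrix power unfolds with the new factor on the right, next to
    \<open>v\<close>; hence \<open>v\<close> is arbitrary in the induction and
    \<open>funpow_swap1\<close> closes the case.\<close>
  have "(A ^\<^sub>m Suc m) *\<^sub>v v = (A ^\<^sub>m m) *\<^sub>v (A *\<^sub>v v)"
    using A Suc.prems assoc_mult_mat_vec[OF pow_carrier_mat[OF A] A] by simp
  also have "\<dots> = ((\<lambda>w. A *\<^sub>v w) ^^ m) (A *\<^sub>v v)"
    using A Suc by auto
  finally show ?case by (simp add: funpow_swap1)
qed (use A in auto)

text \<open>By \<open>uw\<close>, \<open>u - w\<close> is orthogonal to \<open>w\<close>, so this is
  Pythagoras with the square of \<open>u - w\<close> dropped.\<close>

lemma scalar_prod_square_le:
  fixes u w :: "real vec"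
  assumes u: "u \<in> carrier_vec n" and w: "w \<in> carrier_vec n" and uw: "u \<bullet> w = w \<bullet> w"
  shows "w \<bullet> w \<le> u \<bullet> u"
proof -
  have "0 \<le> (\<Sum>i = 0..<n. (u $ i - w $ i)\<^sup>2)"
    by (simp add: sum_nonneg)
  also have "\<dots> = u \<bullet> u - 2 * (u \<bullet> w) + w \<bullet> w"
    using u w by (simp add: scalar_prod_def power2_diff power2_eq_square sum.distrib
        sum_subtractf sum_distrib_left algebra_simps)
  finally show ?thesis using uw by simp
qed

text \<open>Row \<open>i\<close> of \<open>transpose_mat C * K\<close> has the entries of
  \<open>transpose_mat K *\<^sub>v col C i\<close>, so summing the squares row by row separates the
  columns of \<open>C\<close>.\<close>

lemma frobenius_norm_transpose_mult:
  assumes "C \<in> carrier_mat n m" "K \<in> carrier_mat n p"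
  shows "(frobenius_norm (transpose_mat C * K))\<^sup>2
    = (\<Sum>i<m. (transpose_mat K *\<^sub>v col C i) \<bullet> (transpose_mat K *\<^sub>v col C i))"
proof -
  have "(frobenius_norm (transpose_mat C * K))\<^sup>2 = (\<Sum>i<m. \<Sum>j<p. (col C i \<bullet> col K j)\<^sup>2)"
    using assms by (simp add: frobenius_norm_def sum_nonneg)
  also have "\<dots> = (\<Sum>i<m. (transpose_mat K *\<^sub>v col C i) \<bullet> (transpose_mat K *\<^sub>v col C i))"
  proof (rule sum.cong[OF refl])
    fix i assume "i \<in> {..<m}"
    have "col C i \<bullet> col K j = col K j \<bullet> col C i" for j
      using assms by (intro comm_scalar_prod[of _ n]) auto
    then show "(\<Sum>j<p. (col C i \<bullet> col K j)\<^sup>2)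
        = (transpose_mat K *\<^sub>v col C i) \<bullet> (transpose_mat K *\<^sub>v col C i)"
      using assms by (auto simp: scalar_prod_def[of "transpose_mat K *\<^sub>v col C i"]
          power2_eq_square lessThan_atLeast0 intro!: sum.cong)
  qed
  finally show ?thesis .
qed

section \<open>The cyclic shift: index formula, period and orthogonality\<close>

abbreviation shift_vec :: "nat \<Rightarrow> real vec \<Rightarrow> real vec" where
  "shift_vec n \<equiv> (*\<^sub>v) (cyclic_shift n)"

lemma cyclic_shift_carrier [simp]: "cyclic_shift n \<in> carrier_mat n n"
  by (simp add: cyclic_shift_def)

lemma shift_vec_funpow_carrier [simp]:
  "v \<in> carrier_vec n \<Longrightarrow> (shift_vec n ^^ m) v \<in> carrier_vec n"
  by (induction m) (auto intro: mult_mat_vec_carrier[OF cyclic_shift_carrier])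

text \<open>Naming an entry by its destination avoids subtraction modulo \<open>n\<close>; iterating
  then only adds to the index.\<close>

lemma shift_vec_index:
  assumes "v \<in> carrier_vec n" "i < n"
  shows "shift_vec n v $ (Suc i mod n) = v $ i"
  using assms by (cases "Suc i = n") (auto simp: cyclic_shift_mult_vec)

lemma shift_vec_funpow_index:
  assumes "v \<in> carrier_vec n" "i < n"
  shows "(shift_vec n ^^ m) v $ ((i + m) mod n) = v $ i"
proof (induction m)
  case (Suc m)
  have "(i + Suc m) mod n = Suc ((i + m) mod n) mod n"
    by (simp add: mod_Suc_eq)
  then show ?case
    using Suc assms shift_vec_index[of "(shift_vec n ^^ m) v" n "(i + m) mod n"] by simp
qed (use assms in auto)

lemma shift_vec_funpow_period:
  assumes "v \<in> carrier_vec n"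
  shows "(shift_vec n ^^ n) v = v"
proof (rule eq_vecI)
  fix i assume "i < dim_vec v"
  then show "(shift_vec n ^^ n) v $ i = v $ i"
    using shift_vec_funpow_index[of v n i n] assms by simp
qed (use assms shift_vec_funpow_carrier[of v n n] in auto)

lemma cyclic_shift_orthogonal:
  "transpose_mat (cyclic_shift n) * cyclic_shift n = 1\<^sub>m n"
proof (rule eq_matI)
  fix i j assume "i < dim_row (1\<^sub>m n :: real mat)" "j < dim_col (1\<^sub>m n :: real mat)"
  then have ij: "i < n" "j < n" by auto
  have "(transpose_mat (cyclic_shift n) * cyclic_shift n) $$ (i, j)
      = (\<Sum>l = 0..<n. (if l = Suc i mod n then 1 else 0) * (if l = Suc j mod n then 1 else 0))"
    using ij by (simp add: cyclic_shift_def scalar_prod_def)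
  also have "\<dots> = (\<Sum>l = 0..<n. if l = Suc i mod n then (if l = Suc j mod n then 1 else 0) else 0)"
    by (rule sum.cong) auto
  also have "\<dots> = (if Suc i mod n = Suc j mod n then 1 else 0)"
    using ij by simp
  \<comment> \<open>The map \<open>Suc\<close> modulo \<open>n\<close> is injective on indices below
    \<open>n\<close>.\<close>
  also have "\<dots> = 1\<^sub>m n $$ (i, j)"
    using ij by (auto simp: mod_Suc split: if_splits)
  finally show "(transpose_mat (cyclic_shift n) * cyclic_shift n) $$ (i, j) = 1\<^sub>m n $$ (i, j)" .
qed (auto simp: cyclic_shift_def)

lemma shift_vec_funpow_scalar_prod:
  assumes u: "u \<in> carrier_vec n" and v: "v \<in> carrier_vec n"
  shows "(shift_vec n ^^ m) u \<bullet> (shift_vec n ^^ m) v = u \<bullet> v"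
proof (induction m)
  case (Suc m)
  let ?T = "cyclic_shift n"
  define x y where "x = (shift_vec n ^^ m) u" and "y = (shift_vec n ^^ m) v"
  have x: "x \<in> carrier_vec n" and y: "y \<in> carrier_vec n"
    using u v by (auto simp: x_def y_def)
  have "(?T *\<^sub>v x) \<bullet> (?T *\<^sub>v y) = (transpose_mat ?T *\<^sub>v (?T *\<^sub>v x)) \<bullet> y"
    using x y by (intro transpose_vec_mult_scalar[symmetric, where nr = n and nc = n])
      (auto intro: mult_mat_vec_carrier[OF cyclic_shift_carrier])
  also have "transpose_mat ?T *\<^sub>v (?T *\<^sub>v x) = (transpose_mat ?T * ?T) *\<^sub>v x"
    using x by (intro assoc_mult_mat_vec[symmetric, where ?n\<^sub>1.0 = n and ?n\<^sub>2.0 = n]) auto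
  also have "\<dots> = x" using x by (simp add: cyclic_shift_orthogonal)
  finally show ?case using Suc by (simp add: x_def y_def)
qed simp

section \<open>Circulant matrices and their commutation with the shift\<close>

lemma circ_carrier: "v \<in> carrier_vec n \<Longrightarrow> circ v \<in> carrier_mat n n"
  by (auto simp: circ_def Let_def)

lemma col_circ:
  assumes v: "v \<in> carrier_vec n" and i: "i < n"
  shows "col (circ v) i = (shift_vec n ^^ i) v"
proof -
  have "(cyclic_shift n ^\<^sub>m i) *\<^sub>v v = (shift_vec n ^^ i) v"
    by (rule pow_mat_mult_vec[OF cyclic_shift_carrier v])
  then show ?thesis
    using v i shift_vec_funpow_carrier[OF v, of i] by (simp add: circ_def Let_def)
qed

text \<open>Column \<open>j\<close> of either product is the shift applied \<open>Suc j\<close>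
  times to \<open>v\<close>: on the right the shift matrix selects the cyclically next column, on
  the left it advances column \<open>j\<close>.\<close>

lemma circ_cyclic_shift_commute:
  assumes v: "v \<in> carrier_vec n"
  shows "circ v * cyclic_shift n = cyclic_shift n * circ v"
proof (rule mat_col_eqI)
  note K = circ_carrier[OF v]
  fix j assume "j < dim_col (cyclic_shift n * circ v)"
  then have j: "j < n" using K by simp
  then have j': "Suc j mod n < n" by simp
  have "col (circ v * cyclic_shift n) j = col (circ v) (Suc j mod n)"
  proof (rule eq_vecI)
    fix i assume "i < dim_vec (col (circ v) (Suc j mod n))"
    then have i: "i < n" using K by simp
    have "col (circ v * cyclic_shift n) j $ i
        = (\<Sum>l = 0..<n. circ v $$ (i, l) * (if l = Suc j mod n then 1 else 0))"
      using K i j by (simp add: cyclic_shift_def scalar_prod_def)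
    also have "\<dots> = (\<Sum>l = 0..<n. if l = Suc j mod n then circ v $$ (i, l) else 0)"
      by (rule sum.cong) auto
    finally show "col (circ v * cyclic_shift n) j $ i = col (circ v) (Suc j mod n) $ i"
      using K i j' by simp
  qed (use K in auto)
  also have "\<dots> = (shift_vec n ^^ Suc j) v"
  \<comment> \<open>The last column wraps around to column 0, which is \<open>v\<close>; periodicity
    identifies it with the \<open>n\<close>-fold shift.\<close>
  proof (cases "Suc j = n")
    case True
    then show ?thesis
      using j shift_vec_funpow_period[OF v] by (simp add: col_circ[OF v])
  next
    case False
    then show ?thesis using j by (simp add: col_circ[OF v])
  qed
  also have "\<dots> = col (cyclic_shift n * circ v) j"
    using col_mult2[OF cyclic_shift_carrier K j] j by (simp add: col_circ[OF v])
  finally show "col (circ v * cyclic_shift n) j = col (cyclic_shift n * circ v) j" .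
qed (use circ_carrier[OF v] in \<open>auto simp: cyclic_shift_def\<close>)

text \<open>Transposing \<open>comm\<close> shows that the two transposes commute; multiplying by
  \<open>T\<close> on both sides cancels \<open>transpose_mat T\<close>.\<close>

lemma commute_transpose_orthogonal:
  fixes K T :: "'a :: field mat"
  assumes K: "K \<in> carrier_mat n n" and T: "T \<in> carrier_mat n n"
    and orth: "transpose_mat T * T = 1\<^sub>m n" and comm: "K * T = T * K"
  shows "transpose_mat K * T = T * transpose_mat K"
proof -
  let ?K = "transpose_mat K" and ?T = "transpose_mat T"
  have K': "?K \<in> carrier_mat n n" and T': "?T \<in> carrier_mat n n" using K T by auto
  \<comment> \<open>A left inverse of a square matrix over a field is also a right inverse.\<close>
  have orth': "T * ?T = 1\<^sub>m n"
    using mat_mult_left_right_inverse[OF T' T orth] .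
  have tr: "?T * ?K = ?K * ?T"
    using comm transpose_mult[OF K T] transpose_mult[OF T K] by simp
  have "?K * T = (T * ?T) * (?K * T)"
    using K' T by (simp add: orth')
  also have "\<dots> = T * ((?T * ?K) * T)"
    using K' T T' by (simp add: assoc_mult_mat[where ?n\<^sub>1.0 = n and ?n\<^sub>2.0 = n and ?n\<^sub>3.0 = n and ?n\<^sub>4.0 = n])
  also have "\<dots> = T * (?K * (?T * T))"
    using K' T T' by (simp add: tr assoc_mult_mat[where ?n\<^sub>1.0 = n and ?n\<^sub>2.0 = n and ?n\<^sub>3.0 = n and ?n\<^sub>4.0 = n])
  also have "\<dots> = T * ?K"
    using K' by (simp add: orth)
  finally show ?thesis .
qed

text \<open>Both factors of the Gram matrix commute with the shift. The product stays nested because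
  moving \<open>transpose_mat K\<close> across a scalar product yields this form.\<close>

lemma circ_gram_shift_vec_funpow:
  assumes k: "k \<in> carrier_vec n" and v: "v \<in> carrier_vec n"
  shows "circ k *\<^sub>v (transpose_mat (circ k) *\<^sub>v (shift_vec n ^^ m) v)
    = (shift_vec n ^^ m) (circ k *\<^sub>v (transpose_mat (circ k) *\<^sub>v v))"
proof (induction m)
  case (Suc m)
  let ?K = "circ k" and ?T = "cyclic_shift n"
  define x where "x = (shift_vec n ^^ m) v"
  have x: "x \<in> carrier_vec n" using v by (simp add: x_def)
  note K = circ_carrier[OF k]
  have K': "transpose_mat ?K \<in> carrier_mat n n" using K by simp
  note T = cyclic_shift_carrier[of n]
  have y: "transpose_mat ?K *\<^sub>v x \<in> carrier_vec n"
    using K' x by (rule mult_mat_vec_carrier)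
  have "transpose_mat ?K *\<^sub>v (?T *\<^sub>v x) = ?T *\<^sub>v (transpose_mat ?K *\<^sub>v x)"
    using commute_transpose_orthogonal[OF K T cyclic_shift_orthogonal circ_cyclic_shift_commute[OF k]]
    by (metis K' T assoc_mult_mat_vec x)
  moreover have "?K *\<^sub>v (?T *\<^sub>v (transpose_mat ?K *\<^sub>v x)) = ?T *\<^sub>v (?K *\<^sub>v (transpose_mat ?K *\<^sub>v x))"
    using circ_cyclic_shift_commute[OF k] by (metis K T assoc_mult_mat_vec y)
  ultimately show ?case using Suc by (simp add: x_def)
qed simp

section \<open>The KKT system and optimality\<close>

lemma shift_vec_funpow_smult:
  assumes "v \<in> carrier_vec n"
  shows "(shift_vec n ^^ m) (c \<cdot>\<^sub>v v) = c \<cdot>\<^sub>v (shift_vec n ^^ m) v"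
  using assms by (induction m) (auto simp: mult_mat_vec[OF cyclic_shift_carrier])

text \<open>The upper block row is stationarity of the Lagrangian, the lower one is the constraint.
  Solving the upper one for \<open>M *\<^sub>v b\<close> produces the factor
  \<open>- lam / 2\<close>.\<close>

lemma kkt_system_iff:
  fixes M :: "real mat" and k b :: "real vec" and lam :: real
  assumes M: "M \<in> carrier_mat n n" and k: "k \<in> carrier_vec n" and b: "b \<in> carrier_vec n"
  shows "four_block_mat (2 \<cdot>\<^sub>m M) (mat_of_cols n [k]) (mat_of_row k) (0\<^sub>m 1 1)
        *\<^sub>v (b @\<^sub>v vec_of_list [lam]) = 0\<^sub>v n @\<^sub>v vec_of_list [1]
    \<longleftrightarrow> M *\<^sub>v b = (- lam / 2) \<cdot>\<^sub>v k \<and> k \<bullet> b = 1"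
proof -
  have lam: "vec_of_list [lam] \<in> carrier_vec 1"
    by (rule carrier_vecI) simp
  have top: "(2 \<cdot>\<^sub>m M) *\<^sub>v b + mat_of_cols n [k] *\<^sub>v vec_of_list [lam]
      = 2 \<cdot>\<^sub>v (M *\<^sub>v b) + lam \<cdot>\<^sub>v k"
    using M k b by (intro eq_vecI) (auto simp: scalar_prod_def mat_of_cols_def sum_distrib_left
        mult.assoc mult_mat_vec_def)
  have bot: "mat_of_row k *\<^sub>v b + 0\<^sub>m 1 1 *\<^sub>v vec_of_list [lam] = vec_of_list [k \<bullet> b]"
    using k b by (intro eq_vecI) (auto simp: mat_of_row_def mult_mat_vec_def scalar_prod_def)
  have "four_block_mat (2 \<cdot>\<^sub>m M) (mat_of_cols n [k]) (mat_of_row k) (0\<^sub>m 1 1)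
        *\<^sub>v (b @\<^sub>v vec_of_list [lam]) = (2 \<cdot>\<^sub>v (M *\<^sub>v b) + lam \<cdot>\<^sub>v k) @\<^sub>v vec_of_list [k \<bullet> b]"
    unfolding top[symmetric] bot[symmetric]
    by (rule four_block_mat_mult_vec[where ?nr1.0 = n and ?nc1.0 = n and ?nr2.0 = 1 and ?nc2.0 = 1])
      (use M k b lam in auto)
  moreover have "2 \<cdot>\<^sub>v (M *\<^sub>v b) + lam \<cdot>\<^sub>v k \<in> carrier_vec n"
    using M k b by auto
  moreover have "2 \<cdot>\<^sub>v (M *\<^sub>v b) + lam \<cdot>\<^sub>v k = 0\<^sub>v n \<longleftrightarrow> M *\<^sub>v b = (- lam / 2) \<cdot>\<^sub>v k"
    using M k b by (auto simp: vec_eq_iff field_simps add_eq_0_iff)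
  moreover have "vec_of_list [k \<bullet> b] = vec_of_list [1] \<longleftrightarrow> k \<bullet> b = 1"
    by (metis list_vec list.inject)
  ultimately show ?thesis
    by (simp add: append_vec_eq[where n = n])
qed

theorem lemma1:
  fixes n :: nat and k b :: "real vec" and lam :: real and K B :: "real mat"
  assumes "k \<in> carrier_vec n"
    and "b \<in> carrier_vec n"
    and "K = circ k"
    and "B = circ b"
    and "four_block_mat (2 \<cdot>\<^sub>m (K * transpose_mat K)) (mat_of_cols n [k])
           (mat_of_row k) (0\<^sub>m 1 1) *\<^sub>v (b @\<^sub>v vec_of_list [lam])
         = 0\<^sub>v n @\<^sub>v vec_of_list [1]"
  shows "is_arg_min (\<lambda>C. (frobenius_norm (transpose_mat C * K))\<^sup>2)
           (\<lambda>C. C \<in> carrier_mat n n \<and> (\<forall>i<n. col C i \<bullet> col K i = 1)) B"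
proof -
  note k = assms(1) and b = assms(2)
  have K: "K \<in> carrier_mat n n" and B: "B \<in> carrier_mat n n"
    using assms circ_carrier by auto
  have K': "transpose_mat K \<in> carrier_mat n n" using K by simp
  have "(K * transpose_mat K) *\<^sub>v b = (- lam / 2) \<cdot>\<^sub>v k \<and> k \<bullet> b = 1"
    using assms(5) kkt_system_iff[OF mult_carrier_mat[OF K K'] k b] by blast
  then have KKb: "K *\<^sub>v (transpose_mat K *\<^sub>v b) = (- lam / 2) \<cdot>\<^sub>v k" and kb: "k \<bullet> b = 1"
    using assoc_mult_mat_vec[OF K K' b] by auto
  have colK: "col K i = (shift_vec n ^^ i) k" and colB: "col B i = (shift_vec n ^^ i) b"
    if "i < n" for i
    using that assms(3,4) col_circ k b by auto
  have feasible: "col B i \<bullet> col K i = 1" if "i < n" for i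
    using that kb k b comm_scalar_prod[OF k b]
    by (simp add: colK colB shift_vec_funpow_scalar_prod)
  have kkt: "K *\<^sub>v (transpose_mat K *\<^sub>v col B i) = (- lam / 2) \<cdot>\<^sub>v col K i" if "i < n" for i
    using that circ_gram_shift_vec_funpow[OF k b, of i, folded assms(3)] KKb
      shift_vec_funpow_smult[OF k]
    by (simp add: colK colB)
  \<comment> \<open>Moving \<open>transpose_mat K\<close> to the right factor exposes the left side
    of \<open>kkt\<close>; the constraint on \<open>c\<close> then removes all dependence on
    \<open>c\<close>.\<close>
  have cross: "(transpose_mat K *\<^sub>v c) \<bullet> (transpose_mat K *\<^sub>v col B i) = - lam / 2"
    if i: "i < n" and c: "c \<in> carrier_vec n" "c \<bullet> col K i = 1" for i c
  proof -
    have "(transpose_mat K *\<^sub>v c) \<bullet> (transpose_mat K *\<^sub>v col B i)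
        = c \<bullet> (K *\<^sub>v (transpose_mat K *\<^sub>v col B i))"
      using K B c by (intro transpose_vec_mult_scalar) auto
    also have "\<dots> = - lam / 2"
      using K c i by (simp add: kkt)
    finally show ?thesis .
  qed
  have "(frobenius_norm (transpose_mat B * K))\<^sup>2 \<le> (frobenius_norm (transpose_mat C * K))\<^sup>2"
    if C: "C \<in> carrier_mat n n" and con: "\<forall>i<n. col C i \<bullet> col K i = 1" for C
    unfolding frobenius_norm_transpose_mult[OF B K] frobenius_norm_transpose_mult[OF C K]
  proof (rule sum_mono, rule scalar_prod_square_le[where n = n])
    fix i assume "i \<in> {..<n}"
    then have i: "i < n" by simp
    \<comment> \<open>Columns \<open>i\<close> of \<open>C\<close> and of \<open>B\<close> are both
      feasible, so \<open>cross\<close> gives the same value for both.\<close>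
    show "(transpose_mat K *\<^sub>v col C i) \<bullet> (transpose_mat K *\<^sub>v col B i)
        = (transpose_mat K *\<^sub>v col B i) \<bullet> (transpose_mat K *\<^sub>v col B i)"
      using i B C con feasible cross[OF i, of "col C i"] cross[OF i, of "col B i"] by simp
  qed (use K B C in auto)
  then show ?thesis
    using B feasible unfolding is_arg_min_def by (meson not_less)
qed

end
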